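(* Let $M$ be an oriented Riemannian manifold with $\dim M\ge 3$, let $\gamma:I \to M$ be a Frenet helix of order $3$ with Frenet field $\{T,N,B\}$, constant curvature $\kappa$ and constant torsion $\tau$, and let $r \geq 2$ be an integer. Then \[ \tau_r(\gamma)=c\,\Big \{A_3 N+A_1 R(N,T)T+A_2R(N,B)T \Big \}, \] where \[ c=(-1)^r \kappa \left(\kappa^2+\tau ^2\right)^{r-3},\quad A_1= \kappa^2 (r-1)+\tau ^2,\quad A_2= - \kappa \,\tau \,(r - 2),\quad A_3= -\left(\kappa^2+\tau ^2\right)^2 . \]
   Context: $M$ is an oriented Riemannian manifold with Levi-Civita connection $\nabla$ and curvature $R(X,Y)Z=\nabla_X\nabla_YZ-\nabla_Y\nabla_XZ-\nabla_{[X,Y]}Z$. Curves $\gamma:I\to M$ ($I\subset\mathbb{R}$ an interval) are smooth and parametrized by arc length, with unit tangent $T=\gamma'$. Put $\nabla^0_TT=T$, $\nabla_T^kT=\nabla_T(\nabla_T^{k-1}T)$. For an integer $r\ge 2$ the $r$-tension field is \[ \tau_r(\gamma)=\nabla^{2r-1}_T T+ \sum_{\ell=0}^{r-2}(-1)^\ell R\left (\nabla^{2r-3-\ell}_T T ,\nabla^{\ell}_T T\right )T . \] A Frenet helix of order $3$ is such a curve admitting an orthonormal field $\{T,N,B\}$ along $\gamma$ and constants $\kappa>0$, $\tau$ with $\nabla_TT=\kappa N$, $\nabla_TN=-\kappa T+\tau B$, $\nabla_TB=-\tau N$; if $\dim M\ge 4$ then $\tau>0$, while if $\dim M=3$ the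 frame $\{T,N,B\}$ is positively oriented and $\tau$ may be any real number. *)

theory Defs
  imports "HOL-Analysis.Analysis"
begin

section \<open>Smooth maps between Euclidean spaces\<close>

primrec ck_on :: "nat \<Rightarrow> 'e::euclidean_space set \<Rightarrow> ('e \<Rightarrow> 'b::real_normed_vector) \<Rightarrow> bool" where
  "ck_on 0 S = (\<lambda>f. continuous_on S f)"
| "ck_on (Suc k) S = (\<lambda>f. (\<forall>x\<in>S. f differentiable (at x)) \<and>
     (\<forall>v. ck_on k S (\<lambda>x. frechet_derivative f (at x) v)))"

definition smooth_on :: "'e::euclidean_space set \<Rightarrow> ('e \<Rightarrow> 'b::real_normed_vector) \<Rightarrow> bool" where
  "smooth_on S f \<longleftrightarrow> (\<forall>k. ck_on k S f)"

text \<open>Smoothness of a function of one real variable on a set that need not be open (for instance an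
  interval containing its end points, where the derivatives are one-sided): \<open>d n\<close> is the
  \<open>n\<close>-th derivative.\<close>

definition smooth_real_on :: "real set \<Rightarrow> (real \<Rightarrow> real) \<Rightarrow> bool" where
  "smooth_real_on J h \<longleftrightarrow> (\<exists>d :: nat \<Rightarrow> real \<Rightarrow> real. (\<forall>t\<in>J. d 0 t = h t) \<and>
     (\<forall>n. \<forall>t\<in>J. (d n has_real_derivative d (Suc n) t) (at t within J)))"


section \<open>Smooth manifolds\<close>

text \<open>The points of the manifold are the elements of a type \<open>'a\<close>, whose topology is Hausdorff and second
  countable by its sort. A chart is a pair of an open domain and a map into the model space \<open>'e\<close>, so
  that the dimension is \<open>DIM('e)\<close>. Only the values of the map on the domain matter.\<close>

type_synonym ('a, 'e) chart = "'a set \<times> ('a \<Rightarrow> 'e)"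

abbreviation chart_inv :: "('a, 'e) chart \<Rightarrow> 'e \<Rightarrow> 'a" where
  "chart_inv c \<equiv> inv_into (fst c) (snd c)"

definition smooth_atlas ::
  "('a::{t2_space,second_countable_topology}, 'e::euclidean_space) chart set \<Rightarrow> bool" where
  "smooth_atlas A \<longleftrightarrow>
     (\<forall>c\<in>A. open (fst c) \<and> open (snd c ` fst c) \<and>
        homeomorphism (fst c) (snd c ` fst c) (snd c) (chart_inv c)) \<and>
     (\<Union>c\<in>A. fst c) = UNIV \<and>
     (\<forall>c\<in>A. \<forall>d\<in>A. smooth_on (snd c ` (fst c \<inter> fst d)) (snd d \<circ> chart_inv c))"

text \<open>Used for open \<open>U\<close> only.\<close>

definition smooth_fun ::
  "('a::topological_space, 'e::euclidean_space) chart set \<Rightarrow> 'a set \<Rightarrow> ('a \<Rightarrow> real) \<Rightarrow> bool" where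
  "smooth_fun A U f \<longleftrightarrow> (\<forall>c\<in>A. smooth_on (snd c ` (fst c \<inter> U)) (f \<circ> chart_inv c))"

definition smooth_near ::
  "('a::topological_space, 'e::euclidean_space) chart set \<Rightarrow> 'a \<Rightarrow> ('a \<Rightarrow> real) \<Rightarrow> bool" where
  "smooth_near A p f \<longleftrightarrow> (\<exists>U. open U \<and> p \<in> U \<and> smooth_fun A U f)"


section \<open>Tangent vectors and vector fields\<close>

text \<open>Tangent vectors are derivations. The type consists of all functionals on real functions, with
  the pointwise vector space structure; \<open>u \<cdot> f\<close> is the derivative of \<open>f\<close> in the
  direction \<open>u\<close>.\<close>

typedef 'a tangent = "UNIV :: (('a \<Rightarrow> real) \<Rightarrow> real) set"
  morphisms act Tangent ..

notation act (infixl "\<cdot>" 75)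

lemma act_Tangent [simp]: "Tangent F \<cdot> f = F f"
  by (simp add: Tangent_inverse)

lemma tangent_eqI: "(\<And>f. u \<cdot> f = v \<cdot> f) \<Longrightarrow> u = v"
  by (metis act_inverse ext)

instantiation tangent :: (type) real_vector
begin

definition "0 = Tangent (\<lambda>f. 0)"
definition "u + v = Tangent (\<lambda>f. u \<cdot> f + v \<cdot> f)"
definition "u - v = Tangent (\<lambda>f. u \<cdot> f - v \<cdot> f)"
definition "- u = Tangent (\<lambda>f. - (u \<cdot> f))"
definition "a *\<^sub>R u = Tangent (\<lambda>f. a * (u \<cdot> f))"

instance
  by standard (auto intro!: tangent_eqI simp: zero_tangent_def plus_tangent_def minus_tangent_def
    uminus_tangent_def scaleR_tangent_def algebra_simps)

end

text \<open>A derivation at \<open>p\<close> is defined on the functions that are smooth on some neighbourhood of \<open>p\<close>; the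
  value 0 on all other functions is a convention making equality of derivations the equality of
  functionals. That \<open>u \<cdot> f\<close> depends only on the germ of \<open>f\<close> at \<open>p\<close> follows from the Leibniz rule, applied
  to the indicator function of a neighbourhood of \<open>p\<close>.\<close>

definition tangent_space ::
  "('a::topological_space, 'e::euclidean_space) chart set \<Rightarrow> 'a \<Rightarrow> 'a tangent set" where
  "tangent_space A p = {u.
     (\<forall>f. \<not> smooth_near A p f \<longrightarrow> u \<cdot> f = 0) \<and>
     (\<forall>f h. smooth_near A p f \<longrightarrow> smooth_near A p h \<longrightarrow>
        (\<forall>a b. u \<cdot> (\<lambda>q. a * f q + b * h q) = a * (u \<cdot> f) + b * (u \<cdot> h)) \<and>
        u \<cdot> (\<lambda>q. f q * h q) = f p * (u \<cdot> h) + (u \<cdot> f) * h p)}"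

type_synonym 'a vfield = "'a \<Rightarrow> 'a tangent"

definition smooth_vfield ::
  "('a::topological_space, 'e::euclidean_space) chart set \<Rightarrow> 'a set \<Rightarrow> 'a vfield \<Rightarrow> bool" where
  "smooth_vfield A U X \<longleftrightarrow> (\<forall>p\<in>U. X p \<in> tangent_space A p) \<and>
     (\<forall>V f. open V \<longrightarrow> V \<subseteq> U \<longrightarrow> smooth_fun A V f \<longrightarrow> smooth_fun A V (\<lambda>p. X p \<cdot> f))"

definition lie_bracket ::
  "('a::topological_space, 'e::euclidean_space) chart set \<Rightarrow> 'a vfield \<Rightarrow> 'a vfield \<Rightarrow> 'a vfield" where
  "lie_bracket A X Y p = Tangent (\<lambda>f. if smooth_near A p f
     then X p \<cdot> (\<lambda>q. Y q \<cdot> f) - Y p \<cdot> (\<lambda>q. X q \<cdot> f) else 0)"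


section \<open>Coordinates\<close>

text \<open>The coordinates \<open>x\<^sup>b\<close> of a chart and its coordinate fields \<open>\<partial>/\<partial>x\<^sup>b\<close> are indexed by \<open>b \<in> Basis\<close>.\<close>

definition coord :: "('a, 'e::euclidean_space) chart \<Rightarrow> 'e \<Rightarrow> 'a \<Rightarrow> real" where
  "coord c b = (\<lambda>q. snd c q \<bullet> b)"

definition coord_field ::
  "('a::topological_space, 'e::euclidean_space) chart set \<Rightarrow> ('a, 'e) chart \<Rightarrow> 'e \<Rightarrow> 'a vfield" where
  "coord_field A c b p = Tangent (\<lambda>f. if smooth_near A p f
     then frechet_derivative (f \<circ> chart_inv c) (at (snd c p)) b else 0)"

definition chart_at ::
  "('a, 'e) chart set \<Rightarrow> 'a \<Rightarrow> ('a, 'e) chart" where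
  "chart_at A p = (SOME c. c \<in> A \<and> p \<in> fst c)"

text \<open>The extension of a tangent vector to a vector field on the domain of \<open>c\<close> with constant
  components.\<close>

definition extend_field ::
  "('a::topological_space, 'e::euclidean_space) chart set \<Rightarrow> ('a, 'e) chart \<Rightarrow> 'a tangent \<Rightarrow> 'a vfield" where
  "extend_field A c u q = (\<Sum>b\<in>Basis. (u \<cdot> coord c b) *\<^sub>R coord_field A c b q)"


section \<open>Riemannian metrics and orientations\<close>

type_synonym 'a metric_field = "'a \<Rightarrow> 'a tangent \<Rightarrow> 'a tangent \<Rightarrow> real"

definition riemannian_metric ::
  "('a::topological_space, 'e::euclidean_space) chart set \<Rightarrow> 'a metric_field \<Rightarrow> bool" where
  "riemannian_metric A g \<longleftrightarrow>
     (\<forall>p. \<forall>u\<in>tangent_space A p. \<forall>v\<in>tangent_space A p.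
        g p u v = g p v u \<and> (u \<noteq> 0 \<longrightarrow> g p u u > 0) \<and>
        (\<forall>w\<in>tangent_space A p. \<forall>a b. g p (a *\<^sub>R u + b *\<^sub>R v) w = a * g p u w + b * g p v w)) \<and>
     (\<forall>U X Y. open U \<longrightarrow> smooth_vfield A U X \<longrightarrow> smooth_vfield A U Y \<longrightarrow>
        smooth_fun A U (\<lambda>p. g p (X p) (Y p)))"

text \<open>An orientation is given by a nowhere vanishing smooth form \<open>\<omega>\<close> of top degree \<open>DIM('e)\<close>, applied to
  lists of that length; a basis \<open>us\<close> of the tangent space at \<open>p\<close> is positively oriented if
  \<open>\<omega> p us > 0\<close>.\<close>

definition orientation_form ::
  "('a::topological_space, 'e::euclidean_space) chart set \<Rightarrow> ('a \<Rightarrow> 'a tangent list \<Rightarrow> real) \<Rightarrow> bool" where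
  "orientation_form A \<omega> \<longleftrightarrow>
     (\<forall>p us. length us = DIM('e) \<longrightarrow> set us \<subseteq> tangent_space A p \<longrightarrow>
        (\<forall>i<DIM('e). \<forall>u\<in>tangent_space A p. \<forall>v\<in>tangent_space A p. \<forall>a b.
           \<omega> p (us[i := a *\<^sub>R u + b *\<^sub>R v]) = a * \<omega> p (us[i := u]) + b * \<omega> p (us[i := v])) \<and>
        (\<forall>i<DIM('e). \<forall>j<DIM('e). i \<noteq> j \<longrightarrow> us ! i = us ! j \<longrightarrow> \<omega> p us = 0)) \<and>
     (\<forall>p. \<exists>us. length us = DIM('e) \<and> set us \<subseteq> tangent_space A p \<and> \<omega> p us \<noteq> 0) \<and>
     (\<forall>U Xs. open U \<longrightarrow> length Xs = DIM('e) \<longrightarrow> (\<forall>X\<in>set Xs. smooth_vfield A U X) \<longrightarrow>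
        smooth_fun A U (\<lambda>p. \<omega> p (map (\<lambda>X. X p) Xs)))"

definition oriented_riemannian_manifold ::
  "('a::{t2_space,second_countable_topology}, 'e::euclidean_space) chart set \<Rightarrow> 'a metric_field \<Rightarrow>
     ('a \<Rightarrow> 'a tangent list \<Rightarrow> real) \<Rightarrow> bool" where
  "oriented_riemannian_manifold A g \<omega> \<longleftrightarrow>
     smooth_atlas A \<and> riemannian_metric A g \<and> orientation_form A \<omega>"


section \<open>Levi-Civita connection and curvature\<close>

type_synonym 'a connection = "'a vfield \<Rightarrow> 'a vfield \<Rightarrow> 'a vfield"

text \<open>A connection acts on vector fields defined on arbitrary open subsets \<open>U\<close> of the manifold, as
  every connection does by locality; \<open>U = UNIV\<close> gives the global vector fields. A field on \<open>U\<close> is a total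
  function whose values outside \<open>U\<close> are irrelevant: multiplying by the indicator function of \<open>U\<close>, which
  is smooth on \<open>U\<close>, shows that \<open>nab X Y p\<close> depends only on \<open>X\<close> and \<open>Y\<close> near \<open>p\<close>.\<close>

definition affine_connection ::
  "('a::topological_space, 'e::euclidean_space) chart set \<Rightarrow> 'a connection \<Rightarrow> bool" where
  "affine_connection A nab \<longleftrightarrow>
     (\<forall>U X X' Y Y' f. open U \<longrightarrow>
        smooth_vfield A U X \<longrightarrow> smooth_vfield A U X' \<longrightarrow>
        smooth_vfield A U Y \<longrightarrow> smooth_vfield A U Y' \<longrightarrow> smooth_fun A U f \<longrightarrow>
        smooth_vfield A U (nab X Y) \<and>
        (\<forall>p\<in>U. nab (\<lambda>q. X q + X' q) Y p = nab X Y p + nab X' Y p \<and>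
               nab (\<lambda>q. f q *\<^sub>R X q) Y p = f p *\<^sub>R nab X Y p \<and>
               nab X (\<lambda>q. Y q + Y' q) p = nab X Y p + nab X Y' p \<and>
               nab X (\<lambda>q. f q *\<^sub>R Y q) p = (X p \<cdot> f) *\<^sub>R Y p + f p *\<^sub>R nab X Y p))"

definition levi_civita ::
  "('a::topological_space, 'e::euclidean_space) chart set \<Rightarrow> 'a metric_field \<Rightarrow> 'a connection \<Rightarrow> bool" where
  "levi_civita A g nab \<longleftrightarrow> affine_connection A nab \<and>
     (\<forall>U X Y Z. open U \<longrightarrow> smooth_vfield A U X \<longrightarrow> smooth_vfield A U Y \<longrightarrow> smooth_vfield A U Z \<longrightarrow>
        (\<forall>p\<in>U. nab X Y p - nab Y X p = lie_bracket A X Y p \<and>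
               X p \<cdot> (\<lambda>q. g q (Y q) (Z q)) = g p (nab X Y p) (Z p) + g p (Y p) (nab X Z p)))"

definition curvature_field ::
  "('a::topological_space, 'e::euclidean_space) chart set \<Rightarrow> 'a connection \<Rightarrow>
     'a vfield \<Rightarrow> 'a vfield \<Rightarrow> 'a vfield \<Rightarrow> 'a vfield" where
  "curvature_field A nab X Y Z p =
     nab X (nab Y Z) p - nab Y (nab X Z) p - nab (lie_bracket A X Y) Z p"

text \<open>The value on tangent vectors at \<open>p\<close>. Since \<open>curvature_field\<close> is tensorial, neither the choice of the
  extensions of \<open>u\<close>, \<open>v\<close>, \<open>w\<close> to vector fields nor that of the chart matters.\<close>

definition curvature ::
  "('a::topological_space, 'e::euclidean_space) chart set \<Rightarrow> 'a connection \<Rightarrow>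
     'a \<Rightarrow> 'a tangent \<Rightarrow> 'a tangent \<Rightarrow> 'a tangent \<Rightarrow> 'a tangent" where
  "curvature A nab p u v w = (let E = extend_field A (chart_at A p)
     in curvature_field A nab (E u) (E v) (E w) p)"


section \<open>Curves\<close>

definition smooth_curve ::
  "('a::topological_space, 'e::euclidean_space) chart set \<Rightarrow> real set \<Rightarrow> (real \<Rightarrow> 'a) \<Rightarrow> bool" where
  "smooth_curve A I \<gamma> \<longleftrightarrow> is_interval I \<and> interior I \<noteq> {} \<and> continuous_on I \<gamma> \<and>
     (\<forall>U f. open U \<longrightarrow> smooth_fun A U f \<longrightarrow> smooth_real_on {t\<in>I. \<gamma> t \<in> U} (\<lambda>t. f (\<gamma> t)))"

definition velocity ::
  "('a::topological_space, 'e::euclidean_space) chart set \<Rightarrow> real set \<Rightarrow> (real \<Rightarrow> 'a) \<Rightarrow>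
     real \<Rightarrow> 'a tangent" where
  "velocity A I \<gamma> t = Tangent (\<lambda>f. if smooth_near A (\<gamma> t) f
     then vector_derivative (\<lambda>s. f (\<gamma> s)) (at t within I) else 0)"

definition smooth_field_along ::
  "('a::topological_space, 'e::euclidean_space) chart set \<Rightarrow> real set \<Rightarrow> (real \<Rightarrow> 'a) \<Rightarrow>
     (real \<Rightarrow> 'a tangent) \<Rightarrow> bool" where
  "smooth_field_along A I \<gamma> V \<longleftrightarrow> (\<forall>t\<in>I. V t \<in> tangent_space A (\<gamma> t)) \<and>
     (\<forall>U f. open U \<longrightarrow> smooth_fun A U f \<longrightarrow> smooth_real_on {t\<in>I. \<gamma> t \<in> U} (\<lambda>t. V t \<cdot> f))"

text \<open>The covariant derivative along \<open>\<gamma>\<close> of a field \<open>V = \<Sum>\<^sub>b V\<^sup>b \<partial>\<^sub>b\<close>, with \<open>V\<^sup>b = V \<cdot> x\<^sup>b\<close>, is given in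
  the coordinates of any chart by
  \<open>\<Sum>\<^sub>b (dV\<^sup>b/dt) \<partial>\<^sub>b + V\<^sup>b \<nabla>\<^sub>T \<partial>\<^sub>b\<close>, where \<open>T = \<gamma>'\<close>. As \<open>nab X Y p\<close> depends on \<open>X\<close> only through \<open>X p\<close>,
  any extension of \<open>T\<close> to a vector field may be used in the last term.\<close>

definition cov_deriv ::
  "('a::topological_space, 'e::euclidean_space) chart set \<Rightarrow> 'a connection \<Rightarrow> real set \<Rightarrow>
     (real \<Rightarrow> 'a) \<Rightarrow> (real \<Rightarrow> 'a tangent) \<Rightarrow> real \<Rightarrow> 'a tangent" where
  "cov_deriv A nab I \<gamma> V t = (let c = chart_at A (\<gamma> t) in
     \<Sum>b\<in>Basis.
       vector_derivative (\<lambda>s. V s \<cdot> coord c b) (at t within I) *\<^sub>R coord_field A c b (\<gamma> t) +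
       (V t \<cdot> coord c b) *\<^sub>R
         nab (extend_field A c (velocity A I \<gamma> t)) (coord_field A c b) (\<gamma> t))"

text \<open>For \<open>r \<ge> 2\<close> all subtractions of natural numbers below are exact.\<close>

definition tension_field ::
  "('a::topological_space, 'e::euclidean_space) chart set \<Rightarrow> 'a connection \<Rightarrow> real set \<Rightarrow>
     nat \<Rightarrow> (real \<Rightarrow> 'a) \<Rightarrow> real \<Rightarrow> 'a tangent" where
  "tension_field A nab I r \<gamma> t =
     (let T = velocity A I \<gamma>; DT = (\<lambda>k. (cov_deriv A nab I \<gamma> ^^ k) T) in
        DT (2 * r - 1) t +
        (\<Sum>l=0..r-2. (-1) ^ l *\<^sub>R curvature A nab (\<gamma> t) (DT (2 * r - 3 - l) t) (DT l t) (T t)))"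

definition frenet_helix3 ::
  "('a::topological_space, 'e::euclidean_space) chart set \<Rightarrow> 'a metric_field \<Rightarrow>
     ('a \<Rightarrow> 'a tangent list \<Rightarrow> real) \<Rightarrow> 'a connection \<Rightarrow> real set \<Rightarrow> (real \<Rightarrow> 'a) \<Rightarrow>
     (real \<Rightarrow> 'a tangent) \<Rightarrow> (real \<Rightarrow> 'a tangent) \<Rightarrow> (real \<Rightarrow> 'a tangent) \<Rightarrow> real \<Rightarrow> real \<Rightarrow> bool" where
  "frenet_helix3 A g \<omega> nab I \<gamma> T N B \<kappa> \<tau> \<longleftrightarrow>
     smooth_curve A I \<gamma> \<and>
     smooth_field_along A I \<gamma> T \<and> smooth_field_along A I \<gamma> N \<and> smooth_field_along A I \<gamma> B \<and>
     (\<forall>t\<in>I. T t = velocity A I \<gamma> t) \<and>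
     (\<forall>t\<in>I. g (\<gamma> t) (T t) (T t) = 1 \<and> g (\<gamma> t) (N t) (N t) = 1 \<and> g (\<gamma> t) (B t) (B t) = 1 \<and>
            g (\<gamma> t) (T t) (N t) = 0 \<and> g (\<gamma> t) (T t) (B t) = 0 \<and> g (\<gamma> t) (N t) (B t) = 0) \<and>
     \<kappa> > 0 \<and>
     (\<forall>t\<in>I. cov_deriv A nab I \<gamma> T t = \<kappa> *\<^sub>R N t \<and>
            cov_deriv A nab I \<gamma> N t = - \<kappa> *\<^sub>R T t + \<tau> *\<^sub>R B t \<and>
            cov_deriv A nab I \<gamma> B t = - \<tau> *\<^sub>R N t) \<and>
     (DIM('e) \<ge> 4 \<longrightarrow> \<tau> > 0) \<and>
     (DIM('e) = 3 \<longrightarrow> (\<forall>t\<in>I. \<omega> (\<gamma> t) [T t, N t, B t] > 0))"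

end

theory Submission
  imports Defs
begin

text \<open>Put \<open>w = \<kappa>\<^sup>2 + \<tau>\<^sup>2\<close>. The Frenet equations give \<open>\<nabla>\<^sup>2\<^sub>T N = - w N\<close>, hence
  \<open>\<nabla>\<^sub>T\<^bsup>2k+1\<^esup> T = \<kappa> (-w)\<^sup>k N\<close> and \<open>\<nabla>\<^sub>T\<^bsup>2k+2\<^esup> T = \<kappa> (-w)\<^sup>k (- \<kappa> T + \<tau> B)\<close>. Since the orders of the two derivatives
  in each curvature term add up to \<open>2r - 3\<close>, one is even and the other odd, and by antisymmetry of \<open>R\<close>
  all terms with \<open>\<ell> \<ge> 1\<close> equal \<open>\<kappa>\<^sup>2 (-w)\<^bsup>r-3\<^esup> R(N, - \<kappa> T + \<tau> B)T\<close>. Only the bilinearity and antisymmetry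
  of \<open>R\<close> are needed; as \<open>\<nabla>\<close> is torsion-free, the bracket \<open>[X, Y]\<close> in \<open>R\<close> may be replaced
  by \<open>\<nabla>\<^sub>X Y - \<nabla>\<^sub>Y X\<close>, so that no calculus of brackets is required.\<close>

section \<open>Functions of class \<open>C\<^sup>k\<close>\<close>

lemma ck_on_has_derivative:
  assumes "ck_on (Suc k) S f" "x \<in> S"
  shows "(f has_derivative frechet_derivative f (at x)) (at x)"
  using assms frechet_derivative_works by auto

text \<open>Derivatives in \<open>ck_on\<close> are taken over a full neighbourhood, and openness of
  \<open>S\<close> supplies one on which both functions agree. This serves formulas that are valid
  only inside a chart domain.\<close>

lemma ck_on_cong:
  assumes "open S" "ck_on k S f" "\<And>x. x \<in> S \<Longrightarrow> f x = h x"
  shows "ck_on k S h"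
  using assms(2,3)
proof (induction k arbitrary: f h)
  case 0
  then show ?case by (auto intro: continuous_on_eq)
next
  case (Suc k)
  have D: "(h has_derivative frechet_derivative f (at x)) (at x)" if "x \<in> S" for x
    using has_derivative_transform_within_open[OF ck_on_has_derivative[OF Suc.prems(1) that] \<open>open S\<close> that]
      Suc.prems(2) by blast
  have "ck_on k S (\<lambda>x. frechet_derivative h (at x) v)" for v
    by (rule Suc.IH[where f = "\<lambda>x. frechet_derivative f (at x) v"])
       (use Suc.prems(1) frechet_derivative_at[OF D] in auto)
  then show ?case using D by (auto simp: differentiable_def)
qed

text \<open>By uniqueness of Frechet derivatives an explicit derivative formula may replace the
  chosen \<open>frechet_derivative\<close>; the closure rules below feed in the sum, product and
  chain rules.\<close>

lemma ck_on_SucI: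
  assumes "open S" "\<And>x. x \<in> S \<Longrightarrow> (f has_derivative f' x) (at x)" "\<And>v. ck_on k S (\<lambda>x. f' x v)"
  shows "ck_on (Suc k) S f"
proof -
  have "ck_on k S (\<lambda>x. frechet_derivative f (at x) v)" for v
    by (rule ck_on_cong[OF assms(1) assms(3)[of v]]) (use frechet_derivative_at[OF assms(2)] in auto)
  then show ?thesis using assms(2) by (auto simp: differentiable_def)
qed

lemma ck_on_SucD: "ck_on (Suc k) S f \<Longrightarrow> ck_on k S f"
proof (induction k arbitrary: f)
  case 0
  then show ?case
    by (auto intro!: continuous_at_imp_continuous_on differentiable_imp_continuous_within)
next
  case (Suc k)
  then show ?case unfolding ck_on.simps(2)[of "Suc k"] ck_on.simps(2)[of k] by blast
qed

lemma ck_on_subset: "ck_on k S f \<Longrightarrow> S' \<subseteq> S \<Longrightarrow> ck_on k S' f"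
  by (induction k arbitrary: f) (auto intro: continuous_on_subset)

lemma ck_on_const: "open S \<Longrightarrow> ck_on k S (\<lambda>x. a)"
proof (induction k arbitrary: a)
  case (Suc k)
  then show ?case by (intro ck_on_SucI[where f' = "\<lambda>x v. 0"]) auto
qed auto

lemma ck_on_bounded_linear:
  assumes "open S" "bounded_linear L" "ck_on k S f"
  shows "ck_on k S (\<lambda>x. L (f x))"
  using assms(3)
proof (induction k arbitrary: f)
  case 0
  then show ?case using assms(2) by (simp add: bounded_linear.continuous_on)
next
  case (Suc k)
  show ?case
    by (rule ck_on_SucI[OF \<open>open S\<close>, where f' = "\<lambda>x v. L (frechet_derivative f (at x) v)"])
       (use Suc bounded_linear.has_derivative[OF assms(2) ck_on_has_derivative[OF Suc.prems]] in auto)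
qed

lemma ck_on_add:
  assumes "open S" "ck_on k S f" "ck_on k S h"
  shows "ck_on k S (\<lambda>x. f x + h x)"
  using assms(2,3)
proof (induction k arbitrary: f h)
  case 0
  then show ?case by (auto intro: continuous_intros)
next
  case (Suc k)
  show ?case
    by (rule ck_on_SucI[OF \<open>open S\<close>,
          where f' = "\<lambda>x v. frechet_derivative f (at x) v + frechet_derivative h (at x) v"])
       (use Suc in \<open>auto intro!: has_derivative_add ck_on_has_derivative\<close>)
qed

lemma ck_on_sum:
  "open S \<Longrightarrow> (\<And>i. i \<in> J \<Longrightarrow> ck_on k S (f i)) \<Longrightarrow> ck_on k S (\<lambda>x. \<Sum>i\<in>J. f i x)"
  by (induction J rule: infinite_finite_induct) (auto intro: ck_on_const ck_on_add)

lemma ck_on_scaleR: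
  assumes "open S" "ck_on k S f" "ck_on k S h"
  shows "ck_on k S (\<lambda>x. f x *\<^sub>R h x)"
  using assms(2,3)
proof (induction k arbitrary: f h)
  case 0
  then show ?case by (auto intro: continuous_intros)
next
  case (Suc k)
  \<comment> \<open>The product rule also contains \<open>f\<close> and \<open>h\<close>
    undifferentiated, so both must be lowered to class \<open>k\<close> before the induction
    hypothesis applies.\<close>
  note k = ck_on_SucD[OF Suc.prems(1)] ck_on_SucD[OF Suc.prems(2)]
  show ?case
    by (rule ck_on_SucI[OF \<open>open S\<close>, where f' = "\<lambda>x v.
          f x *\<^sub>R frechet_derivative h (at x) v + frechet_derivative f (at x) v *\<^sub>R h x"])
       (use Suc k in \<open>auto intro!: ck_on_add[OF \<open>open S\<close>] has_derivative_scaleR ck_on_has_derivative\<close>)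
qed

text \<open>The induction varies \<open>h\<close> and keeps \<phi> fixed. Expanding the inner
  derivative in the basis turns the chain rule into a finite sum of products; the factors
  \<open>?Dh b \<circ> \<phi>\<close> are again compositions with \<phi>, hence covered by the
  induction hypothesis.\<close>

lemma ck_on_compose:
  fixes \<phi> :: "'c::euclidean_space \<Rightarrow> 'd::euclidean_space"
  assumes "open S" "ck_on k S \<phi>" "ck_on k S' h" "\<phi> ` S \<subseteq> S'"
  shows "ck_on k S (h \<circ> \<phi>)"
  using assms(2,3)
proof (induction k arbitrary: h)
  case 0
  then show ?case using assms(4) by (auto intro: continuous_on_compose2)
next
  case (Suc k)
  let ?Dh = "\<lambda>b y. frechet_derivative h (at y) b" and ?D\<phi> = "\<lambda>x v. frechet_derivative \<phi> (at x) v"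
  have k: "ck_on k S \<phi>" using Suc.prems(1) by (rule ck_on_SucD)
  have D: "((h \<circ> \<phi>) has_derivative (\<lambda>v. \<Sum>b\<in>Basis. (?D\<phi> x v \<bullet> b) *\<^sub>R (?Dh b \<circ> \<phi>) x)) (at x)"
    if "x \<in> S" for x
  proof -
    have h: "(h has_derivative (\<lambda>b. ?Dh b (\<phi> x))) (at (\<phi> x))"
      using ck_on_has_derivative[OF Suc.prems(2)] that assms(4) by blast
    then interpret linear "\<lambda>b. ?Dh b (\<phi> x)" by (rule has_derivative_linear)
    have "?Dh (?D\<phi> x v) (\<phi> x) = (\<Sum>b\<in>Basis. (?D\<phi> x v \<bullet> b) *\<^sub>R ?Dh b (\<phi> x))" for v
      by (subst (1) euclidean_representation[symmetric]) (simp add: sum scale)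
    then show ?thesis
      using diff_chain_at[OF ck_on_has_derivative[OF Suc.prems(1) that] h] by (simp add: o_def)
  qed
  have "ck_on k S (\<lambda>x. ?D\<phi> x v \<bullet> b)" for v b
    by (rule ck_on_bounded_linear[OF \<open>open S\<close> bounded_linear_inner_left]) (use Suc.prems in auto)
  moreover have "ck_on k S (?Dh b \<circ> \<phi>)" for b
    by (rule Suc.IH[OF k]) (use Suc.prems in auto)
  ultimately show ?case
    by (intro ck_on_SucI[OF \<open>open S\<close> D] ck_on_sum[OF \<open>open S\<close>] ck_on_scaleR[OF \<open>open S\<close>])
qed

section \<open>Smooth functions and vector fields on a manifold\<close>

lemma act_simps [simp]:
  "(u + v) \<cdot> f = u \<cdot> f + v \<cdot> f" "(u - v) \<cdot> f = u \<cdot> f - v \<cdot> f" "(a *\<^sub>R u) \<cdot> f = a * (u \<cdot> f)"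
  "(0::'a tangent) \<cdot> f = 0"
  by (simp_all add: plus_tangent_def minus_tangent_def scaleR_tangent_def zero_tangent_def)

lemma chart_inv_chart:
  assumes "smooth_atlas A" "c \<in> A" "q \<in> fst c"
  shows "chart_inv c (snd c q) = q"
  using assms unfolding smooth_atlas_def homeomorphism_def by blast

lemma open_chart_dom: "smooth_atlas A \<Longrightarrow> c \<in> A \<Longrightarrow> open (fst c)"
  unfolding smooth_atlas_def by blast

text \<open>Inside the open chart image, the set is the preimage of \<open>U\<close> under the
  continuous inverse chart.\<close>

lemma open_chart_image:
  assumes A: "smooth_atlas A" "c \<in> A" and "open U"
  shows "open (snd c ` (fst c \<inter> U))"
proof -
  have "continuous_on (snd c ` fst c) (chart_inv c)" "open (snd c ` fst c)"
    using A unfolding smooth_atlas_def homeomorphism_def by blast+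
  then have "open (snd c ` fst c \<inter> chart_inv c -` U)"
    using \<open>open U\<close> by (simp add: continuous_on_open_vimage open_Int Int_commute)
  also have "snd c ` fst c \<inter> chart_inv c -` U = snd c ` (fst c \<inter> U)"
    using chart_inv_chart[OF A] by auto
  finally show ?thesis .
qed

lemma chart_at_mem:
  assumes "smooth_atlas A"
  shows "chart_at A p \<in> A" "p \<in> fst (chart_at A p)"
proof -
  have "\<exists>c. c \<in> A \<and> p \<in> fst c" using assms unfolding smooth_atlas_def by blast
  then have "chart_at A p \<in> A \<and> p \<in> fst (chart_at A p)" unfolding chart_at_def by (rule someI_ex)
  then show "chart_at A p \<in> A" "p \<in> fst (chart_at A p)" by auto
qed

lemma smooth_fun_cong:
  assumes A: "smooth_atlas A" and "open U" "smooth_fun A U f" "\<And>q. q \<in> U \<Longrightarrow> f q = h q"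
  shows "smooth_fun A U h"
  unfolding smooth_fun_def smooth_on_def
proof (intro ballI allI)
  fix c k assume c: "c \<in> A"
  show "ck_on k (snd c ` (fst c \<inter> U)) (h \<circ> chart_inv c)"
    by (rule ck_on_cong[OF open_chart_image[OF A c \<open>open U\<close>], where f = "f \<circ> chart_inv c"])
       (use assms c chart_inv_chart[OF A c] in \<open>auto simp: smooth_fun_def smooth_on_def\<close>)
qed

lemma smooth_fun_const: "smooth_atlas A \<Longrightarrow> open U \<Longrightarrow> smooth_fun A U (\<lambda>q. a)"
  unfolding smooth_fun_def smooth_on_def o_def by (auto intro: ck_on_const open_chart_image)

lemma smooth_fun_add:
  "smooth_atlas A \<Longrightarrow> open U \<Longrightarrow> smooth_fun A U f \<Longrightarrow> smooth_fun A U h \<Longrightarrow>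
    smooth_fun A U (\<lambda>q. f q + h q)"
  using ck_on_add open_chart_image unfolding smooth_fun_def smooth_on_def o_def by blast

lemma smooth_fun_mult:
  "smooth_atlas A \<Longrightarrow> open U \<Longrightarrow> smooth_fun A U f \<Longrightarrow> smooth_fun A U h \<Longrightarrow>
    smooth_fun A U (\<lambda>q. f q * h q)"
  using ck_on_scaleR[where 'b = real] open_chart_image
  unfolding smooth_fun_def smooth_on_def o_def real_scaleR_def by blast

lemma smooth_fun_lincomb:
  "smooth_atlas A \<Longrightarrow> open U \<Longrightarrow> smooth_fun A U f \<Longrightarrow> smooth_fun A U h \<Longrightarrow>
    smooth_fun A U (\<lambda>q. a * f q + b * h q)"
  by (intro smooth_fun_add smooth_fun_mult smooth_fun_const)

lemma smooth_fun_subset: "smooth_fun A U f \<Longrightarrow> V \<subseteq> U \<Longrightarrow> smooth_fun A V f"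
  unfolding smooth_fun_def smooth_on_def by (meson Int_mono ck_on_subset image_mono order_refl)

lemma smooth_fun_coord:
  assumes A: "smooth_atlas A" and c: "c \<in> A"
  shows "smooth_fun A (fst c) (coord c b)"
  unfolding smooth_fun_def smooth_on_def
proof (intro ballI allI)
  fix d k assume d: "d \<in> A"
  have "ck_on k (snd d ` (fst d \<inter> fst c)) (snd c \<circ> chart_inv d)"
    using A c d unfolding smooth_atlas_def smooth_on_def by blast
  from ck_on_bounded_linear[OF open_chart_image[OF A d open_chart_dom[OF A c]]
      bounded_linear_inner_left this, of b]
  show "ck_on k (snd d ` (fst d \<inter> fst c)) (coord c b \<circ> chart_inv d)"
    by (simp add: coord_def o_def)
qed

lemma smooth_near_common:
  assumes "smooth_near A p f" "smooth_near A p h"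
  obtains U where "open U" "p \<in> U" "smooth_fun A U f" "smooth_fun A U h"
proof -
  obtain U V where "open U" "p \<in> U" "smooth_fun A U f" "open V" "p \<in> V" "smooth_fun A V h"
    using assms unfolding smooth_near_def by blast
  then show thesis
    by (intro that[of "U \<inter> V"]) (auto intro: smooth_fun_subset)
qed

lemma smooth_near_lincomb:
  "smooth_atlas A \<Longrightarrow> smooth_near A p f \<Longrightarrow> smooth_near A p h \<Longrightarrow>
    smooth_near A p (\<lambda>q. a * f q + b * h q)"
  by (erule (1) smooth_near_common) (auto simp: smooth_near_def intro: smooth_fun_lincomb)

lemma smooth_near_mult:
  "smooth_atlas A \<Longrightarrow> smooth_near A p f \<Longrightarrow> smooth_near A p h \<Longrightarrow> smooth_near A p (\<lambda>q. f q * h q)"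
  by (erule (1) smooth_near_common) (auto simp: smooth_near_def intro: smooth_fun_mult)

section \<open>Derivations at a point and smooth vector fields\<close>

lemma subspace_tangent_space: "subspace (tangent_space A p)"
  by (rule subspaceI) (auto simp: tangent_space_def algebra_simps)

lemma tangent_space_lincomb:
  "u \<in> tangent_space A p \<Longrightarrow> v \<in> tangent_space A p \<Longrightarrow> a *\<^sub>R u + b *\<^sub>R v \<in> tangent_space A p"
  by (simp add: subspace_tangent_space subspace_add subspace_scale)

text \<open>\<open>1\<^sub>U\<close> is idempotent, so the Leibniz rule yields \<open>u \<cdot> 1\<^sub>U = 2 (u \<cdot> 1\<^sub>U)\<close>.\<close>

lemma tangent_indicator:
  assumes A: "smooth_atlas A" and "open U" "p \<in> U" "u \<in> tangent_space A p"
  shows "smooth_fun A U (indicator U)" "u \<cdot> indicator U = 0"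
proof -
  show S: "smooth_fun A U (indicator U)"
    by (rule smooth_fun_cong[OF A \<open>open U\<close> smooth_fun_const[OF A \<open>open U\<close>, of 1]]) auto
  then have "smooth_near A p (indicator U)"
    using assms(2,3) unfolding smooth_near_def by blast
  then have "u \<cdot> (\<lambda>q. indicator U q * indicator U q) =
      indicator U p * (u \<cdot> indicator U) + (u \<cdot> indicator U) * indicator U p"
    using assms(4) unfolding tangent_space_def by blast
  moreover have "(\<lambda>q. indicator U q * indicator U q :: real) = indicator U"
    by (auto simp: indicator_def)
  ultimately show "u \<cdot> indicator U = 0" using assms(3) by simp
qed

text \<open>A constant is a multiple of 1, the indicator function of the whole manifold, which
  derivations annihilate.\<close>

lemma tangent_const:
  assumes A: "smooth_atlas A" and u: "u \<in> tangent_space A p"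
  shows "u \<cdot> (\<lambda>q. a) = 0"
proof -
  have "smooth_near A p (\<lambda>q. 1)"
    using smooth_fun_const[OF A open_UNIV] unfolding smooth_near_def by blast
  then have "u \<cdot> (\<lambda>q. a * 1 + 0 * 1) = a * (u \<cdot> (\<lambda>q. 1)) + 0 * (u \<cdot> (\<lambda>q. 1))"
    using u unfolding tangent_space_def by blast
  moreover have "u \<cdot> (\<lambda>q. 1) = 0"
    using tangent_indicator(2)[OF A open_UNIV UNIV_I u] by (simp add: indicator_def)
  ultimately show ?thesis by simp
qed

lemma smooth_vfield_cong:
  assumes "smooth_atlas A" "smooth_vfield A U X" "\<And>q. q \<in> U \<Longrightarrow> X q = Y q"
  shows "smooth_vfield A U Y"
proof -
  have "smooth_fun A V (\<lambda>p. Y p \<cdot> f)" if "open V" "V \<subseteq> U" "smooth_fun A V f" for V f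
    by (rule smooth_fun_cong[OF assms(1) that(1), where f = "\<lambda>p. X p \<cdot> f"])
       (use assms that in \<open>auto simp: smooth_vfield_def\<close>)
  then show ?thesis using assms by (auto simp: smooth_vfield_def)
qed

lemma smooth_vfield_lincomb:
  assumes "smooth_atlas A" "smooth_vfield A U X" "smooth_vfield A U Y"
  shows "smooth_vfield A U (\<lambda>q. a *\<^sub>R X q + b *\<^sub>R Y q)"
  unfolding smooth_vfield_def
proof (intro conjI ballI allI impI)
  show "a *\<^sub>R X p + b *\<^sub>R Y p \<in> tangent_space A p" if "p \<in> U" for p
    by (rule tangent_space_lincomb) (use assms(2,3) that in \<open>auto simp: smooth_vfield_def\<close>)
  fix V f assume V: "open V" "V \<subseteq> U" "smooth_fun A V f"
  have "smooth_fun A V (\<lambda>p. a * (X p \<cdot> f) + b * (Y p \<cdot> f))"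
    by (rule smooth_fun_lincomb[OF assms(1) V(1)]) (use assms(2,3) V in \<open>auto simp: smooth_vfield_def\<close>)
  then show "smooth_fun A V (\<lambda>p. (a *\<^sub>R X p + b *\<^sub>R Y p) \<cdot> f)" by simp
qed

lemma smooth_vfield_sum:
  assumes "smooth_atlas A" "\<And>i. i \<in> J \<Longrightarrow> smooth_vfield A U (X i)"
  shows "smooth_vfield A U (\<lambda>q. \<Sum>i\<in>J. a i *\<^sub>R X i q)"
  using assms(2)
proof (induction J rule: infinite_finite_induct)
  case (insert i J)
  then show ?case using smooth_vfield_lincomb[OF assms(1), of U "X i" _ "a i" 1] by simp
qed (auto simp: smooth_vfield_def subspace_0[OF subspace_tangent_space] smooth_fun_const[OF assms(1)])

section \<open>Coordinate fields and extensions with constant components\<close>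

text \<open>Linearity and the Leibniz rule are the sum and product rules for functions read in the
  chart \<open>c\<close>.\<close>

lemma coord_field_tangent:
  assumes A: "smooth_atlas A" and c: "c \<in> A" "p \<in> fst c"
  shows "coord_field A c b p \<in> tangent_space A p"
proof -
  have D: "((f \<circ> chart_inv c) has_derivative frechet_derivative (f \<circ> chart_inv c) (at (snd c p)))
      (at (snd c p))" if "smooth_near A p f" for f
  proof -
    obtain U where "p \<in> U" "smooth_fun A U f" using \<open>smooth_near A p f\<close> unfolding smooth_near_def by blast
    then show ?thesis
      using c unfolding smooth_fun_def smooth_on_def by (blast intro: ck_on_has_derivative)
  qed
  show ?thesis
    unfolding tangent_space_def mem_Collect_eq
  proof (intro conjI allI impI)
    fix f h x y assume f: "smooth_near A p f" and h: "smooth_near A p h"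
    note Dl = has_derivative_add[OF has_derivative_mult_right[OF D[OF f], of x]
        has_derivative_mult_right[OF D[OF h], of y]]
    show "coord_field A c b p \<cdot> (\<lambda>q. x * f q + y * h q) =
        x * (coord_field A c b p \<cdot> f) + y * (coord_field A c b p \<cdot> h)"
      using frechet_derivative_at[OF Dl, symmetric] f h smooth_near_lincomb[OF A f h, of x y]
      by (simp add: coord_field_def o_def)
    note Dm = has_derivative_mult[OF D[OF f] D[OF h]]
    show "coord_field A c b p \<cdot> (\<lambda>q. f q * h q) =
        f p * (coord_field A c b p \<cdot> h) + (coord_field A c b p \<cdot> f) * h p"
      using frechet_derivative_at[OF Dm, symmetric] f h smooth_near_mult[OF A f h] chart_inv_chart[OF A c]
      by (simp add: coord_field_def o_def)
  qed (simp add: coord_field_def)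
qed

text \<open>Read in another chart \<open>d\<close>, the function is a directional derivative of the
  representative of \<open>f\<close> in \<open>c\<close>, composed with the transition map from
  \<open>d\<close> to \<open>c\<close>. The differentiation costs one order, hence
  \<open>Suc k\<close> below.\<close>

lemma smooth_vfield_coord_field:
  assumes A: "smooth_atlas A" and c: "c \<in> A"
  shows "smooth_vfield A (fst c) (coord_field A c b)"
  unfolding smooth_vfield_def
proof (intro conjI ballI allI impI coord_field_tangent[OF A c])
  fix V f assume V: "open V" "V \<subseteq> fst c" and f: "smooth_fun A V f"
  show "smooth_fun A V (\<lambda>p. coord_field A c b p \<cdot> f)"
    unfolding smooth_fun_def smooth_on_def
  proof (intro ballI allI)
    fix d k assume d: "d \<in> A"
    let ?S = "snd d ` (fst d \<inter> V)" and ?\<phi> = "snd c \<circ> chart_inv d"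
    let ?D = "\<lambda>y. frechet_derivative (f \<circ> chart_inv c) (at y) b"
    have S: "open ?S" by (rule open_chart_image[OF A d V(1)])
    have "ck_on k (snd d ` (fst d \<inter> fst c)) ?\<phi>"
      using A c d unfolding smooth_atlas_def smooth_on_def by blast
    then have \<phi>: "ck_on k ?S ?\<phi>" by (rule ck_on_subset) (use V in auto)
    have "ck_on (Suc k) (snd c ` (fst c \<inter> V)) (f \<circ> chart_inv c)"
      using f c unfolding smooth_fun_def smooth_on_def by blast
    then have "ck_on k (snd c ` (fst c \<inter> V)) ?D" by simp
    then have "ck_on k ?S (?D \<circ> ?\<phi>)"
      by (rule ck_on_compose[OF S \<phi>]) (use V chart_inv_chart[OF A d] in auto)
    moreover have "smooth_near A q f" if "q \<in> V" for q
      using that V(1) f unfolding smooth_near_def by blast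
    ultimately show "ck_on k ?S ((\<lambda>p. coord_field A c b p \<cdot> f) \<circ> chart_inv d)"
      by (elim ck_on_cong[OF S]) (auto simp: coord_field_def chart_inv_chart[OF A d])
  qed
qed

lemma smooth_vfield_extend_field:
  "smooth_atlas A \<Longrightarrow> c \<in> A \<Longrightarrow> smooth_vfield A (fst c) (extend_field A c u)"
  unfolding extend_field_def by (rule smooth_vfield_sum) (auto intro: smooth_vfield_coord_field)

text \<open>With the chart fixed, extension is linear in the vector, so linearity of
  \<open>curvature\<close> reduces to linearity of \<open>curvature_field\<close> with constant
  coefficients.\<close>

lemma extend_field_lincomb:
  "extend_field A c (a *\<^sub>R u + b *\<^sub>R v) =
    (\<lambda>q. a *\<^sub>R extend_field A c u q + b *\<^sub>R extend_field A c v q)"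
  by (simp add: extend_field_def fun_eq_iff scaleR_left_distrib sum.distrib scaleR_sum_right)

section \<open>Curvature of a torsion-free connection\<close>

locale torsion_free_connection =
  fixes A :: "('a::{t2_space,second_countable_topology}, 'e::euclidean_space) chart set"
    and nab :: "'a connection"
  assumes atlas: "smooth_atlas A"
    and connection: "affine_connection A nab"
    and torsion_free: "\<And>U X Y p. open U \<Longrightarrow> smooth_vfield A U X \<Longrightarrow> smooth_vfield A U Y \<Longrightarrow> p \<in> U \<Longrightarrow>
          nab X Y p - nab Y X p = lie_bracket A X Y p"
begin

section \<open>Locality and linearity of the connection\<close>

lemma smooth_nab:
  assumes "open U" "smooth_vfield A U X" "smooth_vfield A U Y"
  shows "smooth_vfield A U (nab X Y)"
  using connection[unfolded affine_connection_def, rule_format,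
      OF assms(1) assms(2) assms(2) assms(3) assms(3) smooth_fun_const[OF atlas assms(1)]]
  by (rule conjunct1)

text \<open>Fields are cut off by the indicator function of \<open>U\<close>, which is smooth on
  \<open>U\<close>, equals 1 at \<open>p\<close> and is killed by derivations at \<open>p\<close>.
  After the cut-off, fields that agree on \<open>U\<close> are equal as total functions.\<close>

lemma nab_cong:
  assumes U: "open U" "p \<in> U" and X: "smooth_vfield A U X" "\<And>q. q \<in> U \<Longrightarrow> X q = X' q"
    and Y: "smooth_vfield A U Y" "\<And>q. q \<in> U \<Longrightarrow> Y q = Y' q"
  shows "nab X Y p = nab X' Y' p"
proof -
  have X': "smooth_vfield A U X'" and Y': "smooth_vfield A U Y'"
    using smooth_vfield_cong[OF atlas] X Y by blast+
  have ind: "(\<lambda>q. indicator U q *\<^sub>R Z q) = (\<lambda>q. indicator U q *\<^sub>R Z' q)"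
    if "\<And>q. q \<in> U \<Longrightarrow> Z q = Z' q" for Z Z' :: "'a vfield"
    using that by (auto simp: fun_eq_iff indicator_def)
  have drop: "nab (\<lambda>q. indicator U q *\<^sub>R Z q) W p = nab Z W p \<and> nab Z (\<lambda>q. indicator U q *\<^sub>R W q) p = nab Z W p"
    if Z: "smooth_vfield A U Z" and W: "smooth_vfield A U W" for Z W
  proof -
    have "Z p \<in> tangent_space A p" using Z U unfolding smooth_vfield_def by blast
    note i = tangent_indicator[OF atlas U this]
    show ?thesis
      using connection[unfolded affine_connection_def, rule_format, OF U(1) Z Z W W i(1)] U i(2) by simp
  qed
  have "nab X Y p = nab (\<lambda>q. indicator U q *\<^sub>R X' q) Y p"
    using drop[OF X(1) Y(1)] by (simp only: ind[OF X(2)])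
  also have "\<dots> = nab X' (\<lambda>q. indicator U q *\<^sub>R Y q) p" using drop[OF X' Y(1)] by simp
  also have "\<dots> = nab X' Y' p" using drop[OF X' Y'] by (simp only: ind[OF Y(2)])
  finally show ?thesis .
qed

lemma nab_lincomb:
  assumes U: "open U" "p \<in> U" and X: "smooth_vfield A U X" "smooth_vfield A U X'"
    and Y: "smooth_vfield A U Y"
  shows nab_lincomb_left: "nab (\<lambda>q. a *\<^sub>R X q + b *\<^sub>R X' q) Y p = a *\<^sub>R nab X Y p + b *\<^sub>R nab X' Y p"
    and nab_lincomb_right: "nab Y (\<lambda>q. a *\<^sub>R X q + b *\<^sub>R X' q) p = a *\<^sub>R nab Y X p + b *\<^sub>R nab Y X' p"
proof -
  have c: "smooth_fun A U (\<lambda>q. k)" for k by (rule smooth_fun_const[OF atlas U(1)])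
  have s: "smooth_vfield A U (\<lambda>q. k *\<^sub>R Z q)" if "smooth_vfield A U Z" for k Z
    using smooth_vfield_lincomb[OF atlas that that, of k 0] by simp
  note conn = connection[unfolded affine_connection_def, rule_format, OF U(1)]
  have scale: "nab (\<lambda>q. k *\<^sub>R Z q) Y p = k *\<^sub>R nab Z Y p \<and> nab Y (\<lambda>q. k *\<^sub>R Z q) p = k *\<^sub>R nab Y Z p"
    if Z: "smooth_vfield A U Z" for k Z
  proof -
    \<comment> \<open>The Leibniz term differentiates the constant \<open>k\<close> along
      \<open>Y p\<close>, so it vanishes by \<open>tangent_const\<close>.\<close>
    have "Y p \<in> tangent_space A p" using Y U unfolding smooth_vfield_def by blast
    then show ?thesis
      using conn[OF Z Z Y Y c[of k]] conn[OF Y Y Z Z c[of k]] U tangent_const[OF atlas] by simp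
  qed
  show "nab (\<lambda>q. a *\<^sub>R X q + b *\<^sub>R X' q) Y p = a *\<^sub>R nab X Y p + b *\<^sub>R nab X' Y p"
    and "nab Y (\<lambda>q. a *\<^sub>R X q + b *\<^sub>R X' q) p = a *\<^sub>R nab Y X p + b *\<^sub>R nab Y X' p"
    using conn[OF s[OF X(1), of a] s[OF X(2), of b] Y Y c] conn[OF Y Y s[OF X(1), of a] s[OF X(2), of b] c]
      scale[OF X(1), of a] scale[OF X(2), of b] U by auto
qed

section \<open>Bilinearity and antisymmetry of the curvature\<close>

text \<open>Torsion-freeness identifies the bracket with a difference of covariant derivatives on
  all of \<open>U\<close>. That difference is a smooth field, so \<open>nab_cong\<close> can
  substitute it for the bracket inside \<open>nab\<close>.\<close>

lemma curvature_field_eq: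
  assumes U: "open U" "p \<in> U" and XYZ: "smooth_vfield A U X" "smooth_vfield A U Y" "smooth_vfield A U Z"
  shows "curvature_field A nab X Y Z p =
    nab X (nab Y Z) p - nab Y (nab X Z) p - (nab (nab X Y) Z p - nab (nab Y X) Z p)"
proof -
  note XY = smooth_nab[OF U(1) XYZ(1,2)] and YX = smooth_nab[OF U(1) XYZ(2,1)]
  have "nab (\<lambda>q. 1 *\<^sub>R nab X Y q + (-1) *\<^sub>R nab Y X q) Z p = nab (lie_bracket A X Y) Z p"
    using torsion_free[OF U(1) XYZ(1,2)]
    by (intro nab_cong[OF U smooth_vfield_lincomb[OF atlas XY YX] _ XYZ(3)]) auto
  then show ?thesis
    using nab_lincomb_left[OF U XY YX XYZ(3), of 1 "-1"] by (simp add: curvature_field_def)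
qed

text \<open>Each of the four terms in \<open>curvature_field_eq\<close> is linear in the first
  field. Where that field sits in an inner derivative, linearity of the latter is established on all
  of \<open>U\<close>, so that \<open>nab_cong\<close> can pass it to the outer derivative.\<close>

lemma curvature_field_lincomb_left:
  assumes U: "open U" "p \<in> U" and X: "smooth_vfield A U X" "smooth_vfield A U X'"
    and Y: "smooth_vfield A U Y" and Z: "smooth_vfield A U Z"
  shows "curvature_field A nab (\<lambda>q. a *\<^sub>R X q + b *\<^sub>R X' q) Y Z p =
    a *\<^sub>R curvature_field A nab X Y Z p + b *\<^sub>R curvature_field A nab X' Y Z p"
proof -
  note aX = smooth_vfield_lincomb[OF atlas X, of a b]
  note s = smooth_nab[OF U(1)]
  have left: "nab (\<lambda>q. a *\<^sub>R X q + b *\<^sub>R X' q) W q = a *\<^sub>R nab X W q + b *\<^sub>R nab X' W q"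
    if "smooth_vfield A U W" "q \<in> U" for W q
    by (rule nab_lincomb_left[OF U(1) that(2) X that(1)])
  have right: "nab Y (\<lambda>q. a *\<^sub>R X q + b *\<^sub>R X' q) q = a *\<^sub>R nab Y X q + b *\<^sub>R nab Y X' q" if "q \<in> U" for q
    by (rule nab_lincomb_right[OF U(1) that X Y])
  have "nab Y (nab (\<lambda>q. a *\<^sub>R X q + b *\<^sub>R X' q) Z) p = a *\<^sub>R nab Y (nab X Z) p + b *\<^sub>R nab Y (nab X' Z) p"
    using nab_cong[OF U Y refl s[OF aX Z] left[OF Z]]
      nab_lincomb_right[OF U s[OF X(1) Z] s[OF X(2) Z] Y] by simp
  moreover have "nab (nab (\<lambda>q. a *\<^sub>R X q + b *\<^sub>R X' q) Y) Z p =
      a *\<^sub>R nab (nab X Y) Z p + b *\<^sub>R nab (nab X' Y) Z p"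
    using nab_cong[OF U s[OF aX Y] left[OF Y] Z refl]
      nab_lincomb_left[OF U s[OF X(1) Y] s[OF X(2) Y] Z] by simp
  moreover have "nab (nab Y (\<lambda>q. a *\<^sub>R X q + b *\<^sub>R X' q)) Z p =
      a *\<^sub>R nab (nab Y X) Z p + b *\<^sub>R nab (nab Y X') Z p"
    using nab_cong[OF U s[OF Y aX] right Z refl]
      nab_lincomb_left[OF U s[OF Y X(1)] s[OF Y X(2)] Z] by simp
  ultimately show ?thesis
    using left[OF s[OF Y Z] U(2)]
    by (simp add: curvature_field_eq[OF U aX Y Z] curvature_field_eq[OF U X(1) Y Z]
        curvature_field_eq[OF U X(2) Y Z] algebra_simps)
qed

lemma curvature_lincomb_left:
  "curvature A nab p (a *\<^sub>R u + b *\<^sub>R u') v w =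
    a *\<^sub>R curvature A nab p u v w + b *\<^sub>R curvature A nab p u' v w"
  unfolding curvature_def Let_def extend_field_lincomb
  by (rule curvature_field_lincomb_left[OF open_chart_dom[OF atlas chart_at_mem(1)[OF atlas]]
        chart_at_mem(2)[OF atlas]]; rule smooth_vfield_extend_field[OF atlas chart_at_mem(1)[OF atlas]])

text \<open>The right-hand side of \<open>curvature_field_eq\<close> changes sign when
  \<open>X\<close> and \<open>Y\<close> are exchanged.\<close>

lemma curvature_swap: "curvature A nab p v u w = - curvature A nab p u v w"
proof -
  let ?E = "extend_field A (chart_at A p)"
  have E: "smooth_vfield A (fst (chart_at A p)) (?E u)" for u
    by (rule smooth_vfield_extend_field[OF atlas chart_at_mem(1)[OF atlas]])
  show ?thesis
    using curvature_field_eq[OF open_chart_dom[OF atlas chart_at_mem(1)[OF atlas]]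
        chart_at_mem(2)[OF atlas] E E E]
    by (simp add: curvature_def Let_def)
qed

lemma curvature_lincomb_right:
  "curvature A nab p v (a *\<^sub>R u + b *\<^sub>R u') w =
    a *\<^sub>R curvature A nab p v u w + b *\<^sub>R curvature A nab p v u' w"
  by (simp add: curvature_lincomb_left curvature_swap[of p v "a *\<^sub>R u + b *\<^sub>R u'" w]
      curvature_swap[of p v u w] curvature_swap[of p v u' w])

lemma curvature_scale:
  "curvature A nab p (a *\<^sub>R u) (b *\<^sub>R v) w = (a * b) *\<^sub>R curvature A nab p u v w"
  using curvature_lincomb_left[of p a u 0 u "b *\<^sub>R v" w] curvature_lincomb_right[of p u b v 0 v w] by simp

end

section \<open>Covariant derivatives along a curve\<close>

text \<open>A derivative within \<open>I\<close> sees only values on \<open>I\<close>. The Frenet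
  equations, and hence the formulas for iterated derivatives, are known on \<open>I\<close>
  alone.\<close>

lemma cov_deriv_cong:
  assumes "t \<in> I" "\<And>s. s \<in> I \<Longrightarrow> V s = W s"
  shows "cov_deriv A nab I \<gamma> V t = cov_deriv A nab I \<gamma> W t"
proof -
  have "((\<lambda>s. V s \<cdot> f) has_vector_derivative d) (at t within I) \<longleftrightarrow>
      ((\<lambda>s. W s \<cdot> f) has_vector_derivative d) (at t within I)" for f d
    by (rule has_vector_derivative_cong_ev) (use assms in \<open>auto simp: always_eventually\<close>)
  then have "vector_derivative (\<lambda>s. V s \<cdot> f) (at t within I) =
      vector_derivative (\<lambda>s. W s \<cdot> f) (at t within I)" for f
    by (simp add: vector_derivative_def)
  then show ?thesis using assms by (simp add: cov_deriv_def)
qed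

text \<open>\<open>smooth_real_on\<close> differentiates relative to the times spent in the chart
  domain. By continuity of \<gamma> these are relatively open in \<open>I\<close>, so at
  \<open>t\<close> this is the derivative within \<open>I\<close>.\<close>

lemma smooth_field_along_coord_differentiable:
  assumes A: "smooth_atlas A" and \<gamma>: "smooth_curve A I \<gamma>" and V: "smooth_field_along A I \<gamma> V" and "t \<in> I"
  shows "(\<lambda>s. V s \<cdot> coord (chart_at A (\<gamma> t)) b) differentiable (at t within I)"
proof -
  define c where "c = chart_at A (\<gamma> t)"
  let ?J = "{s \<in> I. \<gamma> s \<in> fst c}"
  have c: "c \<in> A" "\<gamma> t \<in> fst c" using chart_at_mem[OF A] by (auto simp: c_def)
  have U: "open (fst c)" by (rule open_chart_dom[OF A c(1)])
  have "smooth_real_on ?J (\<lambda>s. V s \<cdot> coord c b)"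
    using V U smooth_fun_coord[OF A c(1)] unfolding smooth_field_along_def by blast
  then obtain d where d: "\<forall>s\<in>?J. d 0 s = V s \<cdot> coord c b"
    "\<forall>n. \<forall>s\<in>?J. (d n has_real_derivative d (Suc n) s) (at s within ?J)"
    unfolding smooth_real_on_def by blast
  have "continuous_on I \<gamma>" using \<gamma> unfolding smooth_curve_def by blast
  then obtain W where W: "open W" "W \<inter> I = \<gamma> -` fst c \<inter> I"
    using U unfolding continuous_on_open_invariant by blast
  have "(d 0 has_real_derivative d (Suc 0) t) (at t within ?J)" using d(2) c(2) \<open>t \<in> I\<close> by blast
  also have "at t within ?J = at t within I"
    by (rule at_within_nhd[of t W]) (use W c(2) \<open>t \<in> I\<close> in auto)
  finally have "(d 0 has_derivative (*) (d (Suc 0) t)) (at t within I)"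
    by (simp add: has_field_derivative_def)
  \<comment> \<open>\<open>d 0\<close> agrees with the component of \<open>V\<close> only on
    \<open>?J\<close>; this suffices because \<open>?J\<close> contains all points of
    \<open>I\<close> near \<open>t\<close>.\<close>
  then have "((\<lambda>s. V s \<cdot> coord c b) has_derivative (*) (d (Suc 0) t)) (at t within I)"
    by (rule has_derivative_transform_eventually)
       (use d(1) c(2) \<open>t \<in> I\<close> W in \<open>auto simp: eventually_at_topological intro!: exI[of _ W]\<close>)
  then show ?thesis by (auto simp: differentiable_def c_def)
qed

lemma cov_deriv_lincomb:
  assumes A: "smooth_atlas A" and \<gamma>: "smooth_curve A I \<gamma>"
    and V: "smooth_field_along A I \<gamma> V" and W: "smooth_field_along A I \<gamma> W" and t: "t \<in> I"
  shows "cov_deriv A nab I \<gamma> (\<lambda>s. x *\<^sub>R V s + y *\<^sub>R W s) t =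
    x *\<^sub>R cov_deriv A nab I \<gamma> V t + y *\<^sub>R cov_deriv A nab I \<gamma> W t"
proof -
  \<comment> \<open>An interval with nonempty interior has no isolated points, so derivatives within
    \<open>I\<close>, one-sided ones included, are unique; \<open>vector_derivative_within\<close>
    requires this.\<close>
  have I: "is_interval I" "interior I \<noteq> {}" using \<gamma> unfolding smooth_curve_def by auto
  then have "t islimpt I"
    using t by (metis connected_imp_perfect empty_iff interior_singleton is_interval_connected)
  then have nb: "at t within I \<noteq> bot" by (simp add: trivial_limit_within)
  note D = vector_derivative_works[THEN iffD1, OF smooth_field_along_coord_differentiable[OF A \<gamma> _ t]]
  have "vector_derivative (\<lambda>s. (x *\<^sub>R V s + y *\<^sub>R W s) \<cdot> coord (chart_at A (\<gamma> t)) b) (at t within I) =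
      x * vector_derivative (\<lambda>s. V s \<cdot> coord (chart_at A (\<gamma> t)) b) (at t within I) +
      y * vector_derivative (\<lambda>s. W s \<cdot> coord (chart_at A (\<gamma> t)) b) (at t within I)" for b
    by (rule vector_derivative_within[OF nb])
       (auto intro!: has_vector_derivative_add has_vector_derivative_mult_right D V W)
  then show ?thesis
    by (simp add: cov_deriv_def Let_def algebra_simps sum.distrib scaleR_sum_right)
qed

section \<open>Iterated covariant derivatives of the tangent of a helix\<close>

lemma iterated_cov_deriv_helix:
  assumes A: "smooth_atlas A" and helix: "frenet_helix3 A g \<omega> nab I \<gamma> T N B \<kappa> \<tau>" and t: "t \<in> I"
  defines "DT \<equiv> \<lambda>k. (cov_deriv A nab I \<gamma> ^^ k) (velocity A I \<gamma>)"
  shows "DT (2 * k + 1) t = (\<kappa> * (- (\<kappa>\<^sup>2 + \<tau>\<^sup>2)) ^ k) *\<^sub>R N t"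
    and "DT (2 * k + 2) t = (\<kappa> * (- (\<kappa>\<^sup>2 + \<tau>\<^sup>2)) ^ k) *\<^sub>R ((- \<kappa>) *\<^sub>R T t + \<tau> *\<^sub>R B t)"
proof -
  let ?a = "\<lambda>k. \<kappa> * (- (\<kappa>\<^sup>2 + \<tau>\<^sup>2)) ^ k"
  have \<gamma>: "smooth_curve A I \<gamma>"
    and smooth: "smooth_field_along A I \<gamma> T" "smooth_field_along A I \<gamma> N" "smooth_field_along A I \<gamma> B"
    and T: "\<And>t. t \<in> I \<Longrightarrow> velocity A I \<gamma> t = T t"
    and D: "\<And>t. t \<in> I \<Longrightarrow> cov_deriv A nab I \<gamma> T t = \<kappa> *\<^sub>R N t"
      "\<And>t. t \<in> I \<Longrightarrow> cov_deriv A nab I \<gamma> N t = - \<kappa> *\<^sub>R T t + \<tau> *\<^sub>R B t"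
      "\<And>t. t \<in> I \<Longrightarrow> cov_deriv A nab I \<gamma> B t = - \<tau> *\<^sub>R N t"
    using helix unfolding frenet_helix3_def by auto
  note lin = cov_deriv_lincomb[OF A \<gamma>]
  have DT_Suc: "DT (Suc k) = cov_deriv A nab I \<gamma> (DT k)" for k by (simp add: DT_def)
  \<comment> \<open>The parities alternate: \<open>even\<close> differentiates the odd formula, and
    \<open>odd\<close> differentiates the even one. Each is claimed at every time in
    \<open>I\<close>, since the next differentiation uses it along the whole curve.\<close>
  have even: "DT (2 * k + 2) t = ?a k *\<^sub>R ((- \<kappa>) *\<^sub>R T t + \<tau> *\<^sub>R B t)"
    if "\<And>t. t \<in> I \<Longrightarrow> DT (2 * k + 1) t = ?a k *\<^sub>R N t" "t \<in> I" for k t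
  proof -
    have "DT (2 * k + 2) t = cov_deriv A nab I \<gamma> (DT (2 * k + 1)) t"
      using DT_Suc[of "2 * k + 1"] by simp
    \<comment> \<open>The summand \<open>0 *\<^sub>R N t\<close> gives the single term the two-term
      shape of \<open>cov_deriv_lincomb\<close>.\<close>
    also have "\<dots> = cov_deriv A nab I \<gamma> (\<lambda>t. ?a k *\<^sub>R N t + 0 *\<^sub>R N t) t"
      by (rule cov_deriv_cong[OF that(2)]) (use that(1) in simp)
    also have "\<dots> = ?a k *\<^sub>R ((- \<kappa>) *\<^sub>R T t + \<tau> *\<^sub>R B t)"
      by (simp only: lin[OF smooth(2,2) that(2)] D[OF that(2)]) simp
    finally show ?thesis .
  qed
  have odd: "DT (2 * k + 1) t = ?a k *\<^sub>R N t" if "t \<in> I" for k t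
    using that
  proof (induction k arbitrary: t)
    case 0
    then show ?case
      using cov_deriv_cong[of t I "velocity A I \<gamma>" T A nab \<gamma>] T D(1) by (simp add: DT_def)
  next
    case (Suc k)
    have "DT (2 * Suc k + 1) t = cov_deriv A nab I \<gamma> (DT (2 * k + 2)) t"
      using DT_Suc[of "2 * k + 2"] by simp
    also have "\<dots> = cov_deriv A nab I \<gamma> (\<lambda>t. (?a k * - \<kappa>) *\<^sub>R T t + (?a k * \<tau>) *\<^sub>R B t) t"
      by (rule cov_deriv_cong[OF Suc.prems]) (use even[OF Suc.IH] in \<open>simp add: algebra_simps\<close>)
    also have "\<dots> = (?a k * - \<kappa> * \<kappa> + ?a k * \<tau> * - \<tau>) *\<^sub>R N t"
      by (simp only: lin[OF smooth(1,3) Suc.prems] D[OF Suc.prems] scaleR_scaleR scaleR_left_distrib)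
    also have "?a k * - \<kappa> * \<kappa> + ?a k * \<tau> * - \<tau> = ?a (Suc k)"
      by (simp add: power2_eq_square algebra_simps)
    finally show ?case .
  qed
  show "DT (2 * k + 1) t = ?a k *\<^sub>R N t" by (rule odd[OF t])
  show "DT (2 * k + 2) t = ?a k *\<^sub>R ((- \<kappa>) *\<^sub>R T t + \<tau> *\<^sub>R B t)" by (rule even[OF odd t])
qed

section \<open>The r-tension field of a helix\<close>

theorem theorem1p6:
  fixes A :: "('a::{t2_space,second_countable_topology}, 'e::euclidean_space) chart set"
    and g :: "'a metric_field"
    and \<omega> :: "'a \<Rightarrow> 'a tangent list \<Rightarrow> real"
    and nab :: "'a connection"
    and I :: "real set" and \<gamma> :: "real \<Rightarrow> 'a"
    and T N B :: "real \<Rightarrow> 'a tangent"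
    and \<kappa> \<tau> c A1 A2 A3 :: real and r :: nat
  assumes "oriented_riemannian_manifold A g \<omega>"
    and "DIM('e) \<ge> 3"
    and "levi_civita A g nab"
    and "frenet_helix3 A g \<omega> nab I \<gamma> T N B \<kappa> \<tau>"
    and "r \<ge> 2"
    and "c = (-1) ^ r * \<kappa> * (\<kappa>\<^sup>2 + \<tau>\<^sup>2) powi (int r - 3)"
    and "A1 = \<kappa>\<^sup>2 * (real r - 1) + \<tau>\<^sup>2"
    and "A2 = - \<kappa> * \<tau> * (real r - 2)"
    and "A3 = - ((\<kappa>\<^sup>2 + \<tau>\<^sup>2)\<^sup>2)"
  shows "\<forall>t\<in>I. tension_field A nab I r \<gamma> t =
    c *\<^sub>R (A3 *\<^sub>R N t + A1 *\<^sub>R curvature A nab (\<gamma> t) (N t) (T t) (T t)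
                  + A2 *\<^sub>R curvature A nab (\<gamma> t) (N t) (B t) (T t))"
proof
  fix t assume t: "t \<in> I"
  interpret torsion_free_connection A nab
    using assms(1,3) unfolding oriented_riemannian_manifold_def levi_civita_def
    by unfold_locales blast+
  define w where "w = \<kappa>\<^sup>2 + \<tau>\<^sup>2"
  define DT where "DT k = (cov_deriv A nab I \<gamma> ^^ k) (velocity A I \<gamma>)" for k
  define R where "R u v = curvature A nab (\<gamma> t) u v (T t)" for u v
  \<comment> \<open>As \<open>- \<kappa> T + \<tau> B\<close> is the derivative of \<open>N\<close>,
    this is \<open>R\<close> applied to \<open>N\<close>, the derivative of \<open>N\<close>, and
    \<open>T\<close>.\<close>
  define P where "P = (- \<kappa>) *\<^sub>R R (N t) (T t) + \<tau> *\<^sub>R R (N t) (B t)"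
  \<comment> \<open>The shift turns the orders 2r-1 and 2r-3 into 2n+3 and 2n+1, and the sum runs
    from 0 to n.\<close>
  define n where "n = r - 2"
  have r: "r = n + 2" using \<open>r \<ge> 2\<close> by (simp add: n_def)
  have T: "velocity A I \<gamma> t = T t" and "\<kappa> > 0"
    using assms(4) t unfolding frenet_helix3_def by auto
  note D = iterated_cov_deriv_helix[OF atlas assms(4) t, folded w_def DT_def]
  have P: "R (N t) ((- \<kappa>) *\<^sub>R T t + \<tau> *\<^sub>R B t) = P"
    unfolding P_def R_def by (rule curvature_lincomb_right)
  have P': "R ((- \<kappa>) *\<^sub>R T t + \<tau> *\<^sub>R B t) (N t) = - P"
    unfolding P[symmetric] R_def by (rule curvature_swap)
  have scale: "R (a *\<^sub>R u) (b *\<^sub>R v) = (a * b) *\<^sub>R R u v" for a b u v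
    unfolding R_def by (rule curvature_scale)
  let ?t = "\<lambda>l. (-1) ^ l *\<^sub>R R (DT (2 * n + 1 - l) t) (DT l t)"
  \<comment> \<open>The term with index 0 stands apart: \<open>DT 0\<close> is \<open>T\<close>,
    whereas the even-order formula \<open>D(2)\<close> starts at order 2.\<close>
  have first: "?t 0 = (\<kappa> * (-w) ^ n) *\<^sub>R R (N t) (T t)"
    using scale[of _ "N t" 1 "T t"] D(1)[of n] by (simp add: DT_def T)
  have rest: "?t l = (\<kappa>\<^sup>2 * (-w) ^ (n - 1)) *\<^sub>R P" if "l \<in> {1..n}" for l
  proof -
    have *: "\<kappa> * (-w) ^ i * (\<kappa> * (-w) ^ m) = \<kappa>\<^sup>2 * (-w) ^ (n - 1)" if "i + m = n - 1" for i m
      unfolding that[symmetric] power_add power2_eq_square by simp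
    \<comment> \<open>One \<open>m\<close> serves both parities: \<open>l\<close> is 2m+2 or 2m+1,
      its partner order is 2i+1 or 2i+2, and the exponents add up to n-1 in either case. For odd
      \<open>l\<close> the sign of the summand cancels the minus in \<open>P'\<close>, so all these
      terms coincide.\<close>
    define m where "m = (l - 1) div 2"
    define i where "i = n - 1 - m"
    have l: "1 \<le> l" "l \<le> n" using that by auto
    then have im: "i + m = n - 1" unfolding i_def m_def by linarith
    show ?thesis
    proof (cases "even l")
      case True
      then have "l = 2 * m + 2" "2 * n + 1 - l = 2 * i + 1"
        using l unfolding i_def m_def by presburger+
      then show ?thesis using True by (simp only: D scale P *[OF im]) simp
    next
      case False
      then obtain q where q: "l = 2 * q + 1" by (rule oddE)
      then have "m = q" by (simp add: m_def)
      then have "l = 2 * m + 1" "2 * n + 1 - l = 2 * i + 2" using q l by (simp_all add: i_def)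
      then show ?thesis using False by (simp only: D scale P' *[OF im]) simp
    qed
  qed
  have "tension_field A nab I r \<gamma> t = DT (2 * (n + 1) + 1) t + (\<Sum>l=0..n. ?t l)"
    unfolding tension_field_def Let_def r by (simp add: DT_def R_def T)
  also have "(\<Sum>l=0..n. ?t l) = ?t 0 + (\<Sum>l\<in>{1..n}. ?t l)"
    by (subst sum.atLeast_Suc_atMost) auto
  also have "(\<Sum>l\<in>{1..n}. ?t l) = real n *\<^sub>R (\<kappa>\<^sup>2 * (-w) ^ (n - 1)) *\<^sub>R P"
    using rest by (simp add: sum_constant_scaleR)
  finally have tension: "tension_field A nab I r \<gamma> t = (\<kappa> * (-w) ^ (n + 1)) *\<^sub>R N t
      + ((\<kappa> * (-w) ^ n) *\<^sub>R R (N t) (T t) + real n *\<^sub>R (\<kappa>\<^sup>2 * (-w) ^ (n - 1)) *\<^sub>R P)"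
    unfolding first D .
  \<comment> \<open>This is \<open>c\<close> divided by \<kappa>. The exponent is an integer because
    it equals -1 when r = 2; \<kappa> > 0 makes \<open>w\<close> invertible.\<close>
  define e where "e = (-1) ^ n * w powi (int n - 1)"
  have "w \<noteq> 0" using \<open>\<kappa> > 0\<close> by (simp add: w_def sum_power2_eq_zero_iff)
  then have e: "(-w) ^ n = e * w"
    by (simp add: e_def power_int_diff power_minus[of w])
  \<comment> \<open>for \<open>n = 0\<close> the truncated exponent \<open>n - 1\<close> is harmless because of the factor \<open>n\<close>\<close>
  have e': "real n * (-w) ^ (n - 1) = - (real n * e)"
  proof (cases n)
    case (Suc m)
    \<comment> \<open>Here \<open>e\<close> reads \<open>(-w) * (-w) ^ m = e * w\<close>, from which
      the factor \<open>w\<close> is cancelled.\<close>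
    then have "w * ((-w) ^ m + e) = 0" using e by (simp add: algebra_simps)
    then have "(-w) ^ m = - e" using \<open>w \<noteq> 0\<close> by (simp add: add_eq_0_iff2)
    then show ?thesis using Suc by simp
  qed simp
  have "int r - 3 = int n - 1" "(-1::real) ^ r = (-1) ^ n" by (simp_all add: r)
  then have c: "c = \<kappa> * e" unfolding assms(6) e_def w_def by simp
  have A1: "A1 = w + real n * \<kappa>\<^sup>2" unfolding assms(7) r w_def by (simp add: algebra_simps)
  have A2: "A2 = - \<kappa> * \<tau> * real n" unfolding assms(8) r by simp
  have A3: "A3 = - (w * w)" unfolding assms(9) w_def[symmetric] by (simp add: power2_eq_square)
  \<comment> \<open>Coefficients are matched one by one: \<open>c3\<close> for \<open>N\<close>;
    \<open>c1\<close> for \<open>R (N t) (T t)\<close>, which collects \<open>first\<close> and the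
    \<open>T\<close> part of \<open>P\<close>; \<open>c2\<close> for \<open>R (N t) (B t)\<close>,
    which comes from the \<open>B\<close> part of \<open>P\<close> alone.\<close>
  have c3: "\<kappa> * (-w) ^ (n + 1) = c * A3"
    unfolding c A3 power_add power_one_right e by (simp only: ac_simps mult_minus_left mult_minus_right)
  have "\<kappa> * (-w) ^ n + real n * (\<kappa>\<^sup>2 * (-w) ^ (n - 1)) * - \<kappa> =
      \<kappa> * (-w) ^ n - \<kappa> * \<kappa>\<^sup>2 * (real n * (-w) ^ (n - 1))" by (simp only: mult_minus_right ac_simps diff_conv_add_uminus)
  also have "\<dots> = c * A1" unfolding e e' c A1 by (simp add: algebra_simps)
  finally have c1: "\<kappa> * (-w) ^ n + real n * (\<kappa>\<^sup>2 * (-w) ^ (n - 1)) * - \<kappa> = c * A1" .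
  have "real n * (\<kappa>\<^sup>2 * (-w) ^ (n - 1)) * \<tau> = \<kappa>\<^sup>2 * \<tau> * (real n * (-w) ^ (n - 1))"
    by (simp only: ac_simps)
  also have "\<dots> = c * A2" unfolding e' c A2 power2_eq_square by (simp only: ac_simps mult_minus_left mult_minus_right)
  finally have c2: "real n * (\<kappa>\<^sup>2 * (-w) ^ (n - 1)) * \<tau> = c * A2" .
  show "tension_field A nab I r \<gamma> t =
    c *\<^sub>R (A3 *\<^sub>R N t + A1 *\<^sub>R curvature A nab (\<gamma> t) (N t) (T t) (T t)
                  + A2 *\<^sub>R curvature A nab (\<gamma> t) (N t) (B t) (T t))"
    unfolding tension P_def R_def[symmetric] scaleR_right_distrib scaleR_scaleR c1[symmetric]
      c2[symmetric] c3[symmetric] scaleR_left_distrib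
    by (simp only: add.assoc mult.assoc)
qed

end
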